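(* Let $\mathbb{F}$ be a field and $V$ be an infinite-dimensional vector space over $\mathbb{F}$. Let $p_1,p_2,p_3$ be split non-derogatory polynomials of $\mathbb{F}[t]$ with degree $2$. Let $u\in\mathrm{GL}(V)$ have a dominant eigenvalue $\lambda$, and assume that $u$ is a $(p_1,p_2,p_3)$-product in $\mathrm{End}(V)$. Then $\lambda$ is a $(p_1,p_2,p_3)$-product in the algebra $\mathbb{F}$, or $\lambda^2=N(p_1)N(p_2)N(p_3)$.
   Context: A polynomial $p\in\mathbb{F}[t]$ is called non-derogatory if $p(0)\neq 0$. For non-derogatory polynomials $p_1,\dots,p_n$, an element $x$ of a (unital associative) $\mathbb{F}$-algebra $\mathcal{A}$ is called a $(p_1,\dots,p_n)$-product if $x=a_1\cdots a_n$ for some $a_1,\dots,a_n\in\mathcal{A}$ with $p_i(a_i)=0$ for all $i$. For $u\in\mathrm{End}(V)$, a scalar $\lambda\in\mathbb{F}$ is called a dominant eigenvalue of $u$ if $\mathrm{rk}(u-\lambda\,\mathrm{id}_V)<\dim V$ (inequality of cardinals). The norm $N(p)$ of a monic polynomial $p$ of degree $n$ is $(-1)^np(0)$, and the norm of a nonzero polynomial $p$ with leading coefficient $\alpha$ is that of $\alpha^{-1}p$. *)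

theory Defs
  imports
    Main
    "HOL-Algebra.Module"
    "HOL-Computational_Algebra.Polynomial"
begin

unbundle cardinal_syntax

definition non_derogatory :: "'a::field poly \<Rightarrow> bool"
  where "non_derogatory p \<longleftrightarrow> poly p 0 \<noteq> 0"

definition split_poly :: "'a::field poly \<Rightarrow> bool"
  where "split_poly p \<longleftrightarrow>
    (\<exists>c rs. c \<noteq> 0 \<and> p = smult c (\<Prod>r\<leftarrow>rs. [:- r, 1:]))"

definition poly_norm :: "'a::field poly \<Rightarrow> 'a"
  where "poly_norm p = (- 1) ^ degree p * poly (smult (inverse (lead_coeff p)) p) 0"


text \<open>The scalars form a type of class \<open>field\<close>. An algebra over them is a record with an
  explicit carrier, because an endomorphism algebra is not a whole type. It need not be
  commutative, unlike in the locale \<open>algebra\<close> of HOL-Algebra.\<close>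

locale unital_algebra = ring A for A :: "('a::field, 'b) module" (structure) +
  assumes smult_closed: "x \<in> carrier A \<Longrightarrow> c \<odot> x \<in> carrier A"
    and smult_add_left: "x \<in> carrier A \<Longrightarrow> (c + d) \<odot> x = c \<odot> x \<oplus> d \<odot> x"
    and smult_add_right:
      "x \<in> carrier A \<Longrightarrow> y \<in> carrier A \<Longrightarrow> c \<odot> (x \<oplus> y) = c \<odot> x \<oplus> c \<odot> y"
    and smult_assoc: "x \<in> carrier A \<Longrightarrow> (c * d) \<odot> x = c \<odot> (d \<odot> x)"
    and smult_one: "x \<in> carrier A \<Longrightarrow> 1 \<odot> x = x"
    and smult_mult_left:
      "x \<in> carrier A \<Longrightarrow> y \<in> carrier A \<Longrightarrow> (c \<odot> x) \<otimes> y = c \<odot> (x \<otimes> y)"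
    and smult_mult_right:
      "x \<in> carrier A \<Longrightarrow> y \<in> carrier A \<Longrightarrow> x \<otimes> (c \<odot> y) = c \<odot> (x \<otimes> y)"

definition alg_poly :: "('a::field, 'b) module \<Rightarrow> 'a poly \<Rightarrow> 'b \<Rightarrow> 'b"
  where "alg_poly A p x =
    (\<Oplus>\<^bsub>A\<^esub>i\<in>{..degree p}. coeff p i \<odot>\<^bsub>A\<^esub> (x [^]\<^bsub>A\<^esub> i))"

definition is_poly_product :: "('a::field, 'b) module \<Rightarrow> 'a poly list \<Rightarrow> 'b \<Rightarrow> bool"
  where "is_poly_product A ps x \<longleftrightarrow>
    (\<exists>as. length as = length ps \<and>
      (\<forall>i<length ps. as ! i \<in> carrier A \<and> alg_poly A (ps ! i) (as ! i) = \<zero>\<^bsub>A\<^esub>) \<and>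
      x = foldr (\<lambda>a b. a \<otimes>\<^bsub>A\<^esub> b) as \<one>\<^bsub>A\<^esub>)"

definition field_algebra :: "('a::field, 'a) module"
  where "field_algebra =
    \<lparr>carrier = UNIV, monoid.mult = (*), one = 1, zero = 0, add = (+), module.smult = (*)\<rparr>"

definition End_algebra :: "('a::field \<Rightarrow> 'v::ab_group_add \<Rightarrow> 'v) \<Rightarrow> ('a, 'v \<Rightarrow> 'v) module"
  where "End_algebra scale =
    \<lparr>carrier = {f. Vector_Spaces.linear scale scale f},
     monoid.mult = (\<circ>), one = id,
     zero = (\<lambda>v. 0), add = (\<lambda>f g v. f v + g v),
     module.smult = (\<lambda>c f v. scale c (f v))\<rparr>"

text \<open>The library's \<open>dim\<close> is a natural number and is \<open>0\<close> in infinite dimension; here the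
  dimension of the span of \<open>S\<close> is a cardinal, that of any basis. The prefix \<open>Modules\<close> selects
  the linear algebra of the main library, not the locale \<open>module\<close> of HOL-Algebra.\<close>

definition cardinal_dim :: "('a::field \<Rightarrow> 'v::ab_group_add \<Rightarrow> 'v) \<Rightarrow> 'v set \<Rightarrow> 'v rel"
  where "cardinal_dim scale S =
    |SOME B. \<not> Modules.module.dependent scale B \<and>
      Modules.module.span scale B = Modules.module.span scale S|"

definition cardinal_rank :: "('a::field \<Rightarrow> 'v::ab_group_add \<Rightarrow> 'v) \<Rightarrow> ('v \<Rightarrow> 'v) \<Rightarrow> 'v rel"
  where "cardinal_rank scale f = cardinal_dim scale (range f)"

definition dominant_eigenvalue ::
    "('a::field \<Rightarrow> 'v::ab_group_add \<Rightarrow> 'v) \<Rightarrow> ('v \<Rightarrow> 'v) \<Rightarrow> 'a \<Rightarrow> bool"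
  where "dominant_eigenvalue scale u l \<longleftrightarrow>
    cardinal_rank scale (\<lambda>v. u v - scale l v) <o cardinal_dim scale UNIV"


lemma unital_algebra_field_algebra: "unital_algebra (field_algebra :: ('a::field, 'a) module)"
  unfolding field_algebra_def
  by unfold_locales
    (auto simp: algebra_simps Units_def intro: exI[of _ "- x" for x :: 'a] add.right_inverse)

lemma alg_poly_field_algebra: "alg_poly field_algebra p x = poly p x"
proof -
  interpret A: unital_algebra "field_algebra :: ('a, 'a) module"
    by (rule unital_algebra_field_algebra)
  have fs: "finsum field_algebra f I = sum f I" if "finite I" for I :: "nat set" and f :: "nat \<Rightarrow> 'a"
    using that
  proof induction
    case empty
    have "\<zero>\<^bsub>field_algebra\<^esub> = (0::'a)" by (simp add: field_algebra_def)
    then show ?case by simp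
  next
    case (insert i I)
    have "f \<in> insert i I \<rightarrow> carrier field_algebra" by (simp add: field_algebra_def)
    then have "finsum field_algebra f (insert i I) = f i \<oplus>\<^bsub>field_algebra\<^esub> finsum field_algebra f I"
      using insert by (intro A.finsum_insert) auto
    with insert show ?case by (simp add: field_algebra_def)
  qed
  have pw: "x [^]\<^bsub>field_algebra\<^esub> (i::nat) = x ^ i" for i
    by (induction i) (auto, auto simp: field_algebra_def)
  show ?thesis
    by (simp add: alg_poly_def fs pw poly_altdef) (simp add: field_algebra_def)
qed

context vector_space
begin

lemma linear_endo_iff:
  "Vector_Spaces.linear scale scale f \<longleftrightarrow>
    (\<forall>x y. f (x + y) = f x + f y) \<and> (\<forall>c x. f (scale c x) = scale c (f x))"
  using vector_space_axioms
  by (auto simp: Vector_Spaces.linear_iff)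

lemma unital_algebra_End_algebra: "unital_algebra (End_algebra scale)"
proof -
  have "\<exists>g. Vector_Spaces.linear scale scale g \<and> (\<lambda>v. g v + f v) = (\<lambda>v. 0) \<and> (\<lambda>v. f v + g v) = (\<lambda>v. 0)"
    if "Vector_Spaces.linear scale scale f" for f
    using that by (intro exI[of _ "\<lambda>v. - f v"])
      (auto simp: linear_endo_iff algebra_simps)
  then show ?thesis
    unfolding End_algebra_def
    by unfold_locales
      (auto simp: linear_endo_iff Units_def algebra_simps fun_eq_iff scale_right_distrib scale_left_distrib)
qed

lemma Units_End_algebra:
  "Units (End_algebra scale) = {f. Vector_Spaces.linear scale scale f \<and> bij f}"
proof -
  have "\<exists>g. Vector_Spaces.linear scale scale g \<and> g \<circ> f = id \<and> f \<circ> g = id"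
    if "Vector_Spaces.linear scale scale f" "bij f" for f
  proof -
    have "Vector_Spaces.linear scale scale (inv_into UNIV f)"
    proof -
      have i: "f (inv_into UNIV f x) = x" "inv_into UNIV f (f x) = x" for x
        using that(2) by (auto simp: bij_is_surj surj_f_inv_f bij_is_inj)
      from that(1) have "\<And>x y. f (x + y) = f x + f y" "\<And>c x. f (scale c x) = scale c (f x)"
        by (auto simp: linear_endo_iff)
      then show ?thesis
        by (metis i linear_endo_iff)
    qed
    with that(2) show ?thesis
      by (intro exI[of _ "inv_into UNIV f"]) (auto simp: bij_is_inj bij_is_surj fun_eq_iff surj_f_inv_f)
  qed
  then show ?thesis
    by (auto simp: Units_def End_algebra_def intro: o_bij)
qed

lemma alg_poly_End_algebra:
  assumes "Vector_Spaces.linear scale scale f"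
  shows "alg_poly (End_algebra scale) p f = (\<lambda>v. \<Sum>i\<le>degree p. scale (coeff p i) ((f ^^ i) v))"
proof -
  interpret A: unital_algebra "End_algebra scale" by (rule unital_algebra_End_algebra)
  have fs: "finsum (End_algebra scale) g I = (\<lambda>v. \<Sum>i\<in>I. g i v)"
    if "finite I" "\<And>i. g i \<in> carrier (End_algebra scale)" for I :: "nat set" and g
    using that(1)
  proof induction
    case empty
    have "\<zero>\<^bsub>End_algebra scale\<^esub> = (\<lambda>v. 0)" by (simp add: End_algebra_def)
    then show ?case by simp
  next
    case (insert i I)
    then have "finsum (End_algebra scale) g (insert i I) =
        g i \<oplus>\<^bsub>End_algebra scale\<^esub> finsum (End_algebra scale) g I"
      using that(2) by (intro A.finsum_insert) auto
    with insert show ?case by (simp add: End_algebra_def)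
  qed
  have f: "f \<in> carrier (End_algebra scale)" using assms by (simp add: End_algebra_def)
  have pw: "f [^]\<^bsub>End_algebra scale\<^esub> (i::nat) = f ^^ i" for i
    by (induction i)
      (simp_all add: funpow_Suc_right del: funpow.simps(2), simp_all add: End_algebra_def)
  show ?thesis
    unfolding alg_poly_def
    by (subst fs) (use f in \<open>auto intro!: A.smult_closed simp: pw[symmetric]\<close>,
      auto simp: End_algebra_def pw[symmetric])
qed

end

end

theory Submission
  imports Defs
begin

text \<open>Modulo the proper ideal of endomorphisms of rank less than \<open>dim V\<close>, the product
  \<open>a b c\<close> of the three quadratic elements equals \<open>l\<close>. Write \<open>a' = tr a - a\<close>, so that
  \<open>a a' = N a\<close>. The element \<open>z = a b + b' a'\<close> commutes with \<open>a\<close> and \<open>b\<close>, and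
  \<open>l N(c) z\<close> is congruent to \<open>l\<^sup>2 tr c + (N(a) N(b) N(c) - l\<^sup>2) c\<close>. If \<open>l\<^sup>2\<close> differs from the
  product of the norms, then \<open>c\<close> commutes with \<open>a\<close> and \<open>b\<close> modulo the ideal, hence so do \<open>a\<close> and
  \<open>b\<close>, and a common eigenvector in the quotient algebra writes \<open>l\<close> as a product of roots.\<close>

section \<open>Quadratic endomorphisms with trace \<open>t\<close> and norm \<open>n\<close>\<close>

definition quadratic_map ::
    "('a::field \<Rightarrow> 'v::ab_group_add \<Rightarrow> 'v) \<Rightarrow> 'a \<Rightarrow> 'a \<Rightarrow> ('v \<Rightarrow> 'v) \<Rightarrow> bool"
  where "quadratic_map scale t n f \<longleftrightarrow> Vector_Spaces.linear scale scale f \<and>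
    (\<forall>v. f (f v) = scale t (f v) - scale n v)"

context vector_space
begin

lemma linear_endoD:
  assumes "Vector_Spaces.linear scale scale f"
  shows "f (x + y) = f x + f y" "f (x - y) = f x - f y" "f (scale r x) = scale r (f x)"
proof -
  from assms show add: "f (x + y) = f x + f y" and "f (scale r x) = scale r (f x)" for x y r
    by (auto simp: linear_endo_iff)
  from add[of "x - y" y] show "f (x - y) = f x - f y" by simp
qed

lemma quadratic_mapD:
  assumes "quadratic_map scale t n f"
  shows "Vector_Spaces.linear scale scale f" "f (f v) = scale t (f v) - scale n v"
    "f (x + y) = f x + f y" "f (x - y) = f x - f y" "f (scale r x) = scale r (f x)"
  using assms by (auto simp: quadratic_map_def linear_endoD)

lemma linear_conjugate:
  assumes "Vector_Spaces.linear scale scale f"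
  shows "Vector_Spaces.linear scale scale (\<lambda>v. scale t v - f v)"
  using linear_endoD[OF assms]
  by (auto simp: linear_endo_iff algebra_simps)

lemma linear_shift_comp:
  assumes "Vector_Spaces.linear scale scale f" "Vector_Spaces.linear scale scale g"
  shows "Vector_Spaces.linear scale scale (\<lambda>v. f (g v) - scale t (g v))"
  using linear_endoD[OF assms(1)] linear_endoD[OF assms(2)]
  by (auto simp: linear_endo_iff algebra_simps)

text \<open>Expanding gives \<open>z = ab + ba - ta - sb + ts\<close>. By the quadratic relations,
  \<open>[a, ab + ba] = [a^2, b] = s[a, b]\<close>, which the term \<open>- sb\<close> cancels; for
  \<open>b\<close> the term \<open>- ta\<close> does the same.\<close>

lemma trace_form_commutes:
  assumes "quadratic_map scale s m a" "quadratic_map scale t n b"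
  defines "z \<equiv> \<lambda>v. a (b v) + (scale t (scale s v - a v) - b (scale s v - a v))"
  shows "a (z v) = z (a v)" "b (z v) = z (b v)"
  unfolding z_def
  by (simp_all add: quadratic_mapD[OF assms(1)] quadratic_mapD[OF assms(2)] algebra_simps)

end

section \<open>Congruences modulo a proper ideal of endomorphisms\<close>

text \<open>\<open>J f\<close> reads as "\<open>f\<close> is congruent to 0"; the predicate takes
  the place of a quotient algebra. It is not confined to linear maps, so proving \<open>J f\<close>
  asks for no linearity of \<open>f\<close>.\<close>

locale endomorphism_ideal = vector_space scale
  for scale :: "'a::field \<Rightarrow> 'v::ab_group_add \<Rightarrow> 'v" +
  fixes J :: "('v \<Rightarrow> 'v) \<Rightarrow> bool"
  assumes add: "J f \<Longrightarrow> J g \<Longrightarrow> J (\<lambda>v. f v + g v)"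
    and comp_left: "Vector_Spaces.linear scale scale h \<Longrightarrow> J f \<Longrightarrow> J (\<lambda>v. h (f v))"
    and comp_right: "Vector_Spaces.linear scale scale h \<Longrightarrow> J f \<Longrightarrow> J (\<lambda>v. f (h v))"
    and zero: "J (\<lambda>v. 0)"
    and proper: "\<not> J (\<lambda>v. v)"
begin

lemma scaled: "J f \<Longrightarrow> J (\<lambda>v. scale r (f v))"
  by (rule comp_left) (auto simp: linear_endo_iff algebra_simps)

lemma scaledD:
  assumes "J (\<lambda>v. scale r (f v))" "r \<noteq> 0"
  shows "J f"
  using scaled[OF assms(1), of "inverse r"] assms(2) by simp

lemma diff:
  assumes "J f" "J g"
  shows "J (\<lambda>v. f v - g v)"
  using add[OF assms(1) scaled[OF assms(2), of "- 1"]] by simp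

lemma commutes_third_factor:
  assumes a: "quadratic_map scale t1 n1 a" and b: "quadratic_map scale t2 n2 b"
    and c: "quadratic_map scale t3 n3 c"
    and J: "J (\<lambda>v. a (b (c v)) - scale l v)"
    and ne: "l ^ 2 \<noteq> n1 * n2 * n3"
  shows "J (\<lambda>v. c (a v) - a (c v))" "J (\<lambda>v. c (b v) - b (c v))"
proof -
  note A = quadratic_mapD[OF a] and B = quadratic_mapD[OF b] and C = quadratic_mapD[OF c]
  define z where "z = (\<lambda>v. a (b v) + (scale t2 (scale t1 v - a v) - b (scale t1 v - a v)))"
  define w where "w = (\<lambda>v. a (b (c v)) - scale l v)"
  define d where "d = n1 * n2 * n3 - l ^ 2"
  \<comment> \<open>the error in the congruence for \<open>l N(c) z\<close>, see \<open>key\<close>\<close>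
  define e where "e = (\<lambda>v. scale l (w (scale t3 v - c v)) -
    scale n3 (scale t2 (scale t1 (w v) - a (w v)) - b (scale t1 (w v) - a (w v))))"
  have "d \<noteq> 0" using ne by (simp add: d_def)
  have z: "a (z v) = z (a v)" "b (z v) = z (b v)" for v
    unfolding z_def by (rule trace_form_commutes[OF a b])+
  have Jw: "J w" using J by (simp add: w_def)
  have J1: "J (\<lambda>v. w (scale t3 v - c v))"
    using comp_right[OF linear_conjugate[OF C(1)] Jw] .
  have J2: "J (\<lambda>v. scale t2 (scale t1 (w v) - a (w v)) - b (scale t1 (w v) - a (w v)))"
    using comp_left[OF linear_conjugate[OF B(1)] comp_left[OF linear_conjugate[OF A(1)] Jw]] .
  have Je: "J e"
    unfolding e_def by (rule diff[OF scaled[OF J1] scaled[OF J2]])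
  \<comment> \<open>With conjugates \<open>a'\<close>, \<open>b'\<close>, \<open>c'\<close>:
    \<open>w c' = n3 ab - l c'\<close> and \<open>b' a' w = n1 n2 c - l b' a'\<close>. The weights
    \<open>l\<close> and \<open>- n3\<close> in \<open>e\<close> collect \<open>ab\<close> and
    \<open>b' a'\<close> into \<open>z\<close>.\<close>
  have key: "scale d (c v) = scale (l * n3) (z v) - scale (l ^ 2 * t3) v - e v" for v
    unfolding d_def z_def e_def w_def
    by (simp add: A B C algebra_simps power2_eq_square)
  \<comment> \<open>By \<open>key\<close>, \<open>d c\<close> is a combination of \<open>z\<close>
    and the identity, both commuting with \<open>h\<close>, minus \<open>e\<close>; only
    \<open>e\<close> contributes to the commutator.\<close>
  have J3: "J (\<lambda>v. h (c v) - c (h v))"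
    if h: "Vector_Spaces.linear scale scale h" and hz: "\<And>v. h (z v) = z (h v)" for h
  proof (rule scaledD[OF _ \<open>d \<noteq> 0\<close>])
    have "scale d (h (c v) - c (h v)) = e (h v) - h (e v)" for v
    proof -
      have "scale d (h (c v)) = h (scale (l * n3) (z v) - scale (l ^ 2 * t3) v - e v)"
        by (simp only: linear_endoD[OF h] flip: key)
      then show ?thesis
        by (simp add: linear_endoD[OF h] hz key scale_right_diff_distrib)
    qed
    then show "J (\<lambda>v. scale d (h (c v) - c (h v)))"
      using diff[OF comp_right[OF h Je] comp_left[OF h Je]] by simp
  qed
  show "J (\<lambda>v. c (a v) - a (c v))"
    using scaled[OF J3[OF A(1) z(1)], of "- 1"] by simp
  show "J (\<lambda>v. c (b v) - b (c v))"
    using scaled[OF J3[OF B(1) z(2)], of "- 1"] by simp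
qed

text \<open>Since \<open>abc\<close> is congruent to a scalar, it commutes with \<open>a\<close>;
  moving \<open>a\<close> past \<open>c\<close> then puts \<open>a(ab - ba)c\<close> into the ideal.
  The conjugates of \<open>a\<close> and \<open>c\<close> cancel the outer factors up to
  \<open>n1\<close> and \<open>n3\<close>.\<close>

lemma commutes_first_factors:
  assumes a: "quadratic_map scale t1 n1 a" and b: "Vector_Spaces.linear scale scale b"
    and c: "quadratic_map scale t3 n3 c" and "n1 \<noteq> 0" "n3 \<noteq> 0"
    and J: "J (\<lambda>v. a (b (c v)) - scale l v)"
    and ca: "J (\<lambda>v. c (a v) - a (c v))"
  shows "J (\<lambda>v. a (b v) - b (a v))"
proof -
  note A = quadratic_mapD[OF a] and B = b linear_endoD[OF b] and C = quadratic_mapD[OF c]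
  have J1: "J (\<lambda>v. (a (a (b (c v)) - scale l v) - (a (b (c (a v))) - scale l (a v)))
      + a (b (c (a v) - a (c v))))"
    by (intro add diff comp_left[OF A(1)] comp_left[OF B(1)] J ca comp_right[OF A(1) J])
  have "J (\<lambda>v. a (a (b (c v)) - b (a (c v))))"
    using J1 by (simp add: A(3-5) B algebra_simps)
  from comp_right[OF linear_conjugate[OF C(1), of t3]
      comp_left[OF linear_conjugate[OF A(1), of t1] this]]
  \<comment> \<open>Here \<open>v'\<close> is the conjugate of \<open>c\<close> applied to
    \<open>v\<close>, so that \<open>c v' = n3 v\<close>.\<close>
  moreover have "scale t1 (a (a (b (c v')) - b (a (c v')))) - a (a (a (b (c v')) - b (a (c v'))))
      = scale (n1 * n3) (a (b v) - b (a v))" if "v' = scale t3 v - c v" for v v'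
    by (simp add: that A(2-5) B C(2-5) algebra_simps)
  ultimately have "J (\<lambda>v. scale (n1 * n3) (a (b v) - b (a v)))"
    by simp
  then show ?thesis
    using assms(4,5) by (auto intro: scaledD)
qed

text \<open>The quotient algebra acts on itself by left multiplication, and \<open>e\<close> is a
  nonzero vector there. If \<open>(a - x) e\<close> is nonzero, it is an eigenvector for
  \<open>y\<close> because \<open>(a - y)(a - x) = 0\<close>; otherwise \<open>e\<close> is one for
  \<open>x\<close>. The last conclusion carries eigenvalue relations found earlier over to
  \<open>e'\<close>.\<close>

lemma eigen_choice:
  assumes a: "quadratic_map scale (x + y) (x * y) a"
    and e: "\<not> J e" "Vector_Spaces.linear scale scale e"
  obtains r e' where "r = x \<or> r = y" "\<not> J e'" "Vector_Spaces.linear scale scale e'"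
    "J (\<lambda>v. a (e' v) - scale r (e' v))"
    "\<And>h s. \<lbrakk>Vector_Spaces.linear scale scale h; J (\<lambda>v. h (a v) - a (h v));
      J (\<lambda>v. h (e v) - scale s (e v))\<rbrakk> \<Longrightarrow> J (\<lambda>v. h (e' v) - scale s (e' v))"
proof (cases "J (\<lambda>v. a (e v) - scale x (e v))")
  case True
  with e show thesis by (intro that) auto
next
  case False
  note A = quadratic_mapD[OF a]
  show thesis
  proof (rule that[of y "\<lambda>v. a (e v) - scale x (e v)"])
    show "Vector_Spaces.linear scale scale (\<lambda>v. a (e v) - scale x (e v))"
      by (rule linear_shift_comp[OF A(1) e(2)])
    have "a (a (e v) - scale x (e v)) - scale y (a (e v) - scale x (e v)) = 0" for v
      by (simp add: A(2-5) algebra_simps)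
    then show "J (\<lambda>v. a (a (e v) - scale x (e v)) - scale y (a (e v) - scale x (e v)))"
      by (simp add: zero)
  next
    fix h s
    assume h: "Vector_Spaces.linear scale scale h" and ha: "J (\<lambda>v. h (a v) - a (h v))"
      and he: "J (\<lambda>v. h (e v) - scale s (e v))"
    have "J (\<lambda>v. (h (a (e v)) - a (h (e v))) + (a (h (e v) - scale s (e v))
        - scale x (h (e v) - scale s (e v))))"
      by (intro add diff scaled comp_left[OF A(1)] he comp_right[OF e(2) ha])
    then show "J (\<lambda>v. h (a (e v) - scale x (e v)) - scale s (a (e v) - scale x (e v)))"
      by (simp add: linear_endoD[OF h] A(3-5) algebra_simps)
  qed (use False in auto)
qed

lemma quadratic_product_eq_scalar:
  assumes a: "quadratic_map scale (x1 + y1) (x1 * y1) a"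
    and b: "quadratic_map scale (x2 + y2) (x2 * y2) b"
    and c: "quadratic_map scale (x3 + y3) (x3 * y3) c"
    and nz: "x1 * y1 \<noteq> 0" "x3 * y3 \<noteq> 0"
    and J: "J (\<lambda>v. a (b (c v)) - scale l v)"
    and ne: "l ^ 2 \<noteq> (x1 * y1) * (x2 * y2) * (x3 * y3)"
  obtains r1 r2 r3 where "r1 = x1 \<or> r1 = y1" "r2 = x2 \<or> r2 = y2" "r3 = x3 \<or> r3 = y3"
    "l = r1 * r2 * r3"
proof -
  note A = quadratic_mapD[OF a] and B = quadratic_mapD[OF b] and C = quadratic_mapD[OF c]
  note ca = commutes_third_factor(1)[OF a b c J ne]
    and cb = commutes_third_factor(2)[OF a b c J ne]
  note ab = commutes_first_factors[OF a B(1) c nz J ca]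
  have ba: "J (\<lambda>v. b (a v) - a (b v))"
    using scaled[OF ab, of "- 1"] by simp
  \<comment> \<open>The search for a common eigenvector starts from the identity, which
    \<open>proper\<close> keeps out of the ideal.\<close>
  have "Vector_Spaces.linear scale scale (\<lambda>v. v)"
    by (simp add: linear_endo_iff)
  with c proper obtain r3 e3 where e3: "r3 = x3 \<or> r3 = y3" "\<not> J e3"
    "Vector_Spaces.linear scale scale e3" "J (\<lambda>v. c (e3 v) - scale r3 (e3 v))"
    by (rule eigen_choice) blast
  from b e3(2,3) obtain r2 e2 where e2: "r2 = x2 \<or> r2 = y2" "\<not> J e2"
    "Vector_Spaces.linear scale scale e2" "J (\<lambda>v. b (e2 v) - scale r2 (e2 v))"
    "J (\<lambda>v. c (e2 v) - scale r3 (e2 v))"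
    by (rule eigen_choice) (use C(1) cb e3(4) in blast)
  from a e2(2,3) obtain r1 e where e: "r1 = x1 \<or> r1 = y1" "\<not> J e"
    "Vector_Spaces.linear scale scale e" "J (\<lambda>v. a (e v) - scale r1 (e v))"
    "J (\<lambda>v. b (e v) - scale r2 (e v))" "J (\<lambda>v. c (e v) - scale r3 (e v))"
    by (rule eigen_choice) (use B(1) C(1) ba ca e2(4,5) in blast)
  \<comment> \<open>A telescoping sum: in \<open>abc e\<close> the factors \<open>c\<close>,
    \<open>b\<close>, \<open>a\<close> are replaced in turn by \<open>r3\<close>, \<open>r2\<close>,
    \<open>r1\<close>, while \<open>abc e\<close> is also congruent to \<open>l e\<close>.\<close>
  have "J (\<lambda>v. a (b (c (e v) - scale r3 (e v))) + scale r3 (a (b (e v) - scale r2 (e v)))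
      + scale (r3 * r2) (a (e v) - scale r1 (e v)) - (a (b (c (e v))) - scale l (e v)))"
    by (intro add diff scaled comp_left[OF A(1)] comp_left[OF B(1)] e comp_right[OF e(3) J])
  then have "J (\<lambda>v. scale (l - r1 * r2 * r3) (e v))"
    by (simp add: A(3-5) B(3-5) algebra_simps)
  then have "l = r1 * r2 * r3"
    using e(2) scaledD by fastforce
  with e(1) e2(1) e3(1) show thesis by (rule that)
qed

end

section \<open>Cardinal rank and the ideal of small maps\<close>

lemma finite_ordLess_card_of:
  assumes "finite A" "infinite B"
  shows "|A| <o |B|"
proof (rule ordLess_ordLeq_trans)
  show "|A| <o natLeq" using assms(1) by (simp add: finite_iff_ordLess_natLeq)
  show "natLeq \<le>o |B|" using assms(2) infinite_iff_natLeq_ordLeq by blast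
qed

text \<open>Counting spanning sets avoids choosing bases of ranges. For \<open>B\<close> a basis of
  \<open>V\<close> and \<open>f\<close> linear, this says that the rank of \<open>f\<close> is less
  than \<open>dim V\<close>.\<close>

definition small_map :: "('a::field \<Rightarrow> 'v::ab_group_add \<Rightarrow> 'v) \<Rightarrow> 'v set \<Rightarrow> ('v \<Rightarrow> 'v) \<Rightarrow> bool"
  where "small_map scale B f \<longleftrightarrow>
    (\<exists>S. |S| <o |B| \<and> range f \<subseteq> Modules.module.span scale S)"

context vector_space
begin

text \<open>Resolves the choice in \<open>cardinal_dim\<close>: a maximal independent subset of
  \<open>S\<close> shows that a suitable set exists.\<close>

lemma cardinal_dim_basis:
  obtains B where "independent B" "span B = span S" "cardinal_dim scale S = |B|"
proof -
  obtain B0 where "B0 \<subseteq> S" "independent B0" "S \<subseteq> span B0"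
    using maximal_independent_subset by blast
  then have "independent B0 \<and> span B0 = span S"
    by (metis span_mono span_span subset_antisym)
  then have "independent (SOME B. independent B \<and> span B = span S) \<and>
      span (SOME B. independent B \<and> span B = span S) = span S"
    by (rule someI)
  then show thesis
    using that unfolding cardinal_dim_def by blast
qed

text \<open>In a basis \<open>C\<close> containing \<open>B\<close>, the vectors of \<open>S\<close>
  have finite supports, whose union \<open>T\<close> is smaller than \<open>B\<close>. Some
  \<open>b\<close> in \<open>B\<close> is missed, and it would lie in the span of
  \<open>C - {b}\<close>. This makes the ideal of small maps proper.\<close>

lemma independent_not_spanned_by_smaller:
  assumes "independent B" "infinite B" "|S| <o |B|"
  shows "\<not> B \<subseteq> span S"
proof
  assume BS: "B \<subseteq> span S"
  obtain C where C: "B \<subseteq> C" "independent C" "UNIV \<subseteq> span C"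
    using maximal_independent_subset_extend[of B UNIV] assms(1) by auto
  have "\<exists>F. finite F \<and> F \<subseteq> C \<and> s \<in> span F" for s
  proof -
    have "s \<in> span C" using C(3) by blast
    then obtain t r where "finite t" "t \<subseteq> C" "s = (\<Sum>a\<in>t. scale (r a) a)"
      unfolding span_explicit by blast
    then show ?thesis
      by (intro exI[of _ t]) (simp add: span_sum span_scale span_base)
  qed
  then obtain F where F: "\<And>s. finite (F s)" "\<And>s. F s \<subseteq> C" "\<And>s. s \<in> span (F s)"
    by metis
  define T where "T = (\<Union>s\<in>S. F s)"
  have "|T| <o |B|"
  proof (cases "finite S")
    case True
    then have "finite T" using F(1) by (simp add: T_def)
    then show ?thesis using assms(2) by (simp add: finite_ordLess_card_of)
  next
    case False
    then have "|T| \<le>o |S|"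
      unfolding T_def using F(1) ordLess_imp_ordLeq[OF finite_ordLess_card_of]
      by (intro card_of_UNION_ordLeq_infinite) (auto simp: card_of_mono1)
    then show ?thesis using assms(3) by (rule ordLeq_ordLess_trans)
  qed
  then have "\<not> B \<subseteq> T"
    using card_of_mono1 not_ordLess_ordLeq by blast
  then obtain b where b: "b \<in> B" "b \<notin> T" by blast
  have "T \<subseteq> C - {b}" using F(2) b(2) by (auto simp: T_def)
  moreover have "S \<subseteq> span T"
  proof
    fix s assume "s \<in> S"
    then have "F s \<subseteq> T" by (auto simp: T_def)
    then show "s \<in> span T" using F(3) span_mono by blast
  qed
  ultimately have "span S \<subseteq> span (C - {b})"
    by (meson span_minimal span_mono subspace_span order_trans)
  then have "b \<in> span (C - {b})" using BS b(1) by blast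
  then show False using C(1,2) b(1) unfolding dependent_def by blast
qed

text \<open>Sums rest on \<open>|B|\<close> being infinite: two sets smaller than \<open>B\<close>
  have a union smaller than \<open>B\<close>. Composing on the left maps the spanning set; composing
  on the right only shrinks the range.\<close>

lemma endomorphism_ideal_small_map:
  assumes "independent B" "infinite B"
  shows "endomorphism_ideal scale (small_map scale B)"
proof
  fix f g assume "small_map scale B f" "small_map scale B g"
  then obtain S T where S: "|S| <o |B|" "range f \<subseteq> span S" and T: "|T| <o |B|" "range g \<subseteq> span T"
    unfolding small_map_def by blast
  have "f v + g v \<in> span (S \<union> T)" for v
    using S(2) T(2) span_mono[of S "S \<union> T"] span_mono[of T "S \<union> T"] by (auto intro!: span_add)
  moreover have "|S \<union> T| <o |B|"
    using assms(2) S(1) T(1) by (rule card_of_Un_ordLess_infinite)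
  ultimately show "small_map scale B (\<lambda>v. f v + g v)"
    unfolding small_map_def by blast
next
  fix h f assume h: "Vector_Spaces.linear scale scale h" and "small_map scale B f"
  then obtain S where S: "|S| <o |B|" "range f \<subseteq> span S"
    unfolding small_map_def by blast
  have "h ` span S = span (h ` S)"
    using module_hom.span_image[OF h[unfolded linear_iff_module_hom]] by (rule sym)
  then have "range (\<lambda>v. h (f v)) \<subseteq> span (h ` S)"
    using S(2) by auto
  moreover have "|h ` S| <o |B|"
    using card_of_image S(1) by (rule ordLeq_ordLess_trans)
  ultimately show "small_map scale B (\<lambda>v. h (f v))"
    unfolding small_map_def by blast
next
  fix h f assume "small_map scale B f"
  then show "small_map scale B (\<lambda>v. f (h v))"
    unfolding small_map_def by blast
next
  have "B \<noteq> {}" using assms(2) by auto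
  then have "|{}| <o |B|" using assms(2) by (simp add: finite_ordLess_card_of)
  then show "small_map scale B (\<lambda>v. 0)"
    unfolding small_map_def by (intro exI[of _ "{}"]) auto
next
  show "\<not> small_map scale B (\<lambda>v. v)"
    using independent_not_spanned_by_smaller[OF assms] unfolding small_map_def by auto
qed

lemma dominant_eigenvalue_small_map:
  assumes "dominant_eigenvalue scale u l" "\<nexists>B. finite_dimensional_vector_space scale B"
  obtains B where "independent B" "infinite B" "small_map scale B (\<lambda>v. u v - scale l v)"
proof -
  obtain B where B: "independent B" "span B = span UNIV" "cardinal_dim scale UNIV = |B|"
    by (rule cardinal_dim_basis)
  obtain S where S: "span S = span (range (\<lambda>v. u v - scale l v))"
    "cardinal_dim scale (range (\<lambda>v. u v - scale l v)) = |S|"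
    by (rule cardinal_dim_basis)
  have "infinite B"
  proof
    assume "finite B"
    then have "finite_dimensional_vector_space scale B"
      using B(1,2) by unfold_locales auto
    with assms(2) show False by blast
  qed
  moreover have "small_map scale B (\<lambda>v. u v - scale l v)"
    unfolding small_map_def
    using assms(1) S B(3) span_superset[of "range (\<lambda>v. u v - scale l v)"]
    by (intro exI[of _ S]) (simp add: dominant_eigenvalue_def cardinal_rank_def)
  ultimately show thesis using B(1) that by blast
qed

end

section \<open>Split quadratic polynomials and the conclusion\<close>

lemma split_quadratic:
  fixes p :: "'a::field poly"
  assumes "split_poly p" "degree p = 2"
  obtains c x y where "c \<noteq> 0" "p = [:c * (x * y), - (c * (x + y)), c:]"
proof -
  obtain c rs where c: "c \<noteq> 0" "p = smult c (\<Prod>r\<leftarrow>rs. [:- r, 1:])"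
    using assms(1) unfolding split_poly_def by blast
  \<comment> \<open>Nonvanishing is part of the induction because degrees add only for nonzero
    factors.\<close>
  have "(\<Prod>r\<leftarrow>rs. [:- r, 1:]) \<noteq> 0 \<and> degree (\<Prod>r\<leftarrow>rs. [:- r, 1:]) = length rs"
    by (induction rs) (simp_all add: degree_mult_eq del: mult_pCons_left)
  then have "length rs = 2" using assms(2) c by simp
  then obtain x y where "rs = [x, y]"
    by (auto simp: numeral_2_eq_2 length_Suc_conv)
  with c show thesis
    by (intro that[of c x y]) (auto simp: algebra_simps)
qed

text \<open>Dividing \<open>p(f) = 0\<close> by the leading coefficient \<open>c\<close> leaves
  trace \<open>x + y\<close> and norm \<open>x * y\<close>. The sign in \<open>poly_norm\<close> is
  \<open>(- 1)^2\<close>, and \<open>p(0) = c * (x * y)\<close> is nonzero.\<close>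

lemma (in vector_space) split_quadratic_map:
  assumes "split_poly p" "degree p = 2" "non_derogatory p"
    and f: "f \<in> carrier (End_algebra scale)" "alg_poly (End_algebra scale) p f = \<zero>\<^bsub>End_algebra scale\<^esub>"
  obtains x y where "quadratic_map scale (x + y) (x * y) f" "poly p x = 0" "poly p y = 0"
    "poly_norm p = x * y" "x * y \<noteq> 0"
proof -
  obtain c x y where c: "c \<noteq> 0" and p: "p = [:c * (x * y), - (c * (x + y)), c:]"
    using split_quadratic[OF assms(1,2)] .
  have lin: "Vector_Spaces.linear scale scale f"
    using f(1) by (simp add: End_algebra_def)
  have "(\<Sum>i\<le>2. scale (coeff p i) ((f ^^ i) v)) = 0" for v
    using f(2) alg_poly_End_algebra[OF lin, of p] assms(2) by (simp add: End_algebra_def fun_eq_iff)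
  then have "scale c (f (f v) - (scale (x + y) (f v) - scale (x * y) v)) = 0" for v
    by (simp add: p numeral_2_eq_2 algebra_simps)
  then have "quadratic_map scale (x + y) (x * y) f"
    using c lin by (simp add: quadratic_map_def)
  moreover have "poly_norm p = x * y"
    using c by (simp add: poly_norm_def p)
  ultimately show thesis
    using assms(3) by (intro that[of x y]) (auto simp: p non_derogatory_def algebra_simps)
qed

theorem theorem1p3:
  fixes scale :: "'a::field \<Rightarrow> 'v::ab_group_add \<Rightarrow> 'v"
    and p1 p2 p3 :: "'a poly" and u :: "'v \<Rightarrow> 'v" and l :: 'a
  assumes "vector_space scale"
    and "\<nexists>B. finite_dimensional_vector_space scale B"
    and "split_poly p1" and "non_derogatory p1" and "degree p1 = 2"
    and "split_poly p2" and "non_derogatory p2" and "degree p2 = 2"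
    and "split_poly p3" and "non_derogatory p3" and "degree p3 = 2"
    and "u \<in> Units (End_algebra scale)"
    and "dominant_eigenvalue scale u l"
    and "is_poly_product (End_algebra scale) [p1, p2, p3] u"
  shows "is_poly_product field_algebra [p1, p2, p3] l
    \<or> l ^ 2 = poly_norm p1 * poly_norm p2 * poly_norm p3"
proof (rule disjCI)
  assume ne: "l ^ 2 \<noteq> poly_norm p1 * poly_norm p2 * poly_norm p3"
  interpret vector_space scale by (rule assms(1))
  obtain B where B: "independent B" "infinite B" "small_map scale B (\<lambda>v. u v - scale l v)"
    using dominant_eigenvalue_small_map[OF assms(13,2)] .
  \<comment> \<open>Dominance of \<open>l\<close> places \<open>u - l\<close> in this ideal, so the
    factors of \<open>u\<close> multiply to \<open>l\<close> modulo it.\<close>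
  interpret endomorphism_ideal scale "small_map scale B"
    by (rule endomorphism_ideal_small_map[OF B(1,2)])
  obtain as where len: "length as = 3"
    and as: "\<And>i. i < 3 \<Longrightarrow> as ! i \<in> carrier (End_algebra scale) \<and>
      alg_poly (End_algebra scale) ([p1, p2, p3] ! i) (as ! i) = \<zero>\<^bsub>End_algebra scale\<^esub>"
    and u: "u = foldr (\<lambda>a b. a \<otimes>\<^bsub>End_algebra scale\<^esub> b) as \<one>\<^bsub>End_algebra scale\<^esub>"
    using assms(14) unfolding is_poly_product_def by (auto simp: numeral_3_eq_3)
  obtain a b c where abc: "as = [a, b, c]"
    using len by (auto simp: numeral_3_eq_3 length_Suc_conv)
  obtain x1 y1 where 1: "quadratic_map scale (x1 + y1) (x1 * y1) a" "poly p1 x1 = 0" "poly p1 y1 = 0"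
    "poly_norm p1 = x1 * y1" "x1 * y1 \<noteq> 0"
    using split_quadratic_map[OF assms(3,5,4), of a] as[of 0] abc by auto
  obtain x2 y2 where 2: "quadratic_map scale (x2 + y2) (x2 * y2) b" "poly p2 x2 = 0" "poly p2 y2 = 0"
    "poly_norm p2 = x2 * y2"
    using as[of 1] abc by (auto elim!: split_quadratic_map[OF assms(6,8,7)])
  obtain x3 y3 where 3: "quadratic_map scale (x3 + y3) (x3 * y3) c" "poly p3 x3 = 0" "poly p3 y3 = 0"
    "poly_norm p3 = x3 * y3" "x3 * y3 \<noteq> 0"
    using split_quadratic_map[OF assms(9,11,10), of c] as[of 2] abc by auto
  have "u = (\<lambda>v. a (b (c v)))"
    by (simp add: u abc End_algebra_def comp_def)
  with B(3) have "small_map scale B (\<lambda>v. a (b (c v)) - scale l v)" by simp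
  then obtain r1 r2 r3 where r: "r1 = x1 \<or> r1 = y1" "r2 = x2 \<or> r2 = y2" "r3 = x3 \<or> r3 = y3"
    "l = r1 * r2 * r3"
    using quadratic_product_eq_scalar[OF 1(1) 2(1) 3(1) 1(5) 3(5)] ne 1(4) 2(4) 3(4) by metis
  then have "poly p1 r1 = 0" "poly p2 r2 = 0" "poly p3 r3 = 0"
    using 1 2 3 by auto
  \<comment> \<open>In the algebra of scalars the roots themselves are the three factors.\<close>
  with r(4) show "is_poly_product field_algebra [p1, p2, p3] l"
    unfolding is_poly_product_def alg_poly_field_algebra
    by (intro exI[of _ "[r1, r2, r3]"])
      (auto simp: field_algebra_def less_Suc_eq mult.assoc)
qed

end
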